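(* Let $A$ be a (complex) Banach algebra with $\Delta(A)\neq\emptyset$ and let $\phi\in\Delta(A)\cup\{0\}$. If $A$ is $\Delta$-weak $\phi$-amenable, then $A$ has a bounded $\Delta$-weak approximate identity.
   Context: $\Delta(A)$ denotes the set of all nonzero algebra homomorphisms $A\to\mathbb{C}$ (characters; these are automatically bounded), $A^{*}$ the dual space and $A^{**}$ the bidual. For $a\in A$ and $f\in A^{*}$, the functional $f.a\in A^{*}$ is defined by $(f.a)(b)=f(ab)$ for $b\in A$. For $\phi\in\Delta(A)\cup\{0\}$, $A$ is called $\Delta$-weak $\phi$-amenable if there exists $m\in A^{**}$ such that $m(\phi)=0$ and $m(\psi.a)=\psi(a)$ for all $a\in\ker(\phi)$ and all $\psi\in\Delta(A)$. A bounded $\Delta$-weak approximate identity for $A$ is a norm-bounded net $\{e_\alpha\}$ in $A$ such that $\lim_\alpha|\psi(e_\alpha a)-\psi(a)|=0$ for all $a\in A$ and all $\psi\in\Delta(A)$. *)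

theory Defs
  imports "HOL-Analysis.Analysis"
begin

section \<open>Complex Banach algebras\<close>

text \<open>
  Not necessarily unital or commutative.  The distribution has only real Banach algebras, so the
  complex scalar multiplication is added as a parameter whose restriction to the reals is the
  inherited one.  Submultiplicativity of the norm comes from \<^class>\<open>real_normed_algebra\<close>.
\<close>

class complex_banach_algebra = real_normed_algebra + banach +
  fixes scaleC :: "complex \<Rightarrow> 'a \<Rightarrow> 'a"  (infixr \<open>*\<^sub>C\<close> 75)
  assumes scaleC_add_right: "c *\<^sub>C (x + y) = c *\<^sub>C x + c *\<^sub>C y"
    and scaleC_add_left: "(c + d) *\<^sub>C x = c *\<^sub>C x + d *\<^sub>C x"
    and scaleC_scaleC: "c *\<^sub>C (d *\<^sub>C x) = (c * d) *\<^sub>C x"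
    and scaleC_of_real: "complex_of_real r *\<^sub>C x = r *\<^sub>R x"
    and mult_scaleC_left: "(c *\<^sub>C x) * y = c *\<^sub>C (x * y)"
    and mult_scaleC_right: "x * (c *\<^sub>C y) = c *\<^sub>C (x * y)"
    and norm_scaleC: "norm (c *\<^sub>C x) = cmod c * norm x"


section \<open>Characters, dual and bidual\<close>

definition characters :: "('a::complex_banach_algebra \<Rightarrow> complex) set"  (\<open>\<Delta>\<close>) where
  "\<Delta> = {\<psi>. (\<forall>x y. \<psi> (x + y) = \<psi> x + \<psi> y) \<and> (\<forall>c x. \<psi> (c *\<^sub>C x) = c * \<psi> x) \<and>
            (\<forall>x y. \<psi> (x * y) = \<psi> x * \<psi> y) \<and> (\<exists>x. \<psi> x \<noteq> 0)}"

definition dual :: "('a::complex_banach_algebra \<Rightarrow> complex) set" where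
  "dual = {f. bounded_linear f \<and> (\<forall>c x. f (c *\<^sub>C x) = c * f x)}"

text \<open>
  Elements of the bidual are represented by functions whose values outside
  \<^const>\<open>dual\<close> are irrelevant; the norm of the dual is the operator norm \<^const>\<open>onorm\<close>.
\<close>

definition bidual :: "(('a::complex_banach_algebra \<Rightarrow> complex) \<Rightarrow> complex) set" where
  "bidual = {m. (\<forall>f\<in>dual. \<forall>g\<in>dual. m (\<lambda>x. f x + g x) = m f + m g) \<and>
                (\<forall>c. \<forall>f\<in>dual. m (\<lambda>x. c * f x) = c * m f) \<and>
                (\<exists>K. \<forall>f\<in>dual. cmod (m f) \<le> K * onorm f)}"

definition dual_act :: "('a::complex_banach_algebra \<Rightarrow> complex) \<Rightarrow> 'a \<Rightarrow> 'a \<Rightarrow> complex" where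
  "dual_act f a = (\<lambda>b. f (a * b))"

text \<open>
  Characters are automatically bounded.  Hence \<open>\<phi>\<close> and \<open>\<psi>.a\<close> below do lie in the dual, where an
  element of the bidual is meaningful.
\<close>

lemma character_norm_le:
  fixes \<psi> :: "'a::complex_banach_algebra \<Rightarrow> complex"
  assumes "\<psi> \<in> \<Delta>"
  shows "cmod (\<psi> a) \<le> norm a"
proof (rule ccontr)
  assume "\<not> ?thesis"
  then have lt: "norm a < cmod (\<psi> a)" by simp
  then have nz: "\<psi> a \<noteq> 0" by (metis norm_not_less_zero norm_zero)
  have add: "\<And>x y. \<psi> (x + y) = \<psi> x + \<psi> y" and sc: "\<And>c x. \<psi> (c *\<^sub>C x) = c * \<psi> x"
    and mult: "\<And>x y. \<psi> (x * y) = \<psi> x * \<psi> y"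
    using assms by (auto simp: characters_def)
  define b where "b = inverse (\<psi> a) *\<^sub>C a"
  have b1: "\<psi> b = 1" using nz by (simp add: b_def sc)
  have nb: "norm b < 1"
    using lt nz by (simp add: b_def norm_scaleC norm_inverse norm_divide field_simps)
  have "dist (b + b * x) (b + b * y) \<le> norm b * dist x y" for x y
    using norm_mult_ineq[of b "x - y"] by (simp add: dist_norm right_diff_distrib)
  then have "\<exists>!x. b + b * x = x"
    using nb by (intro banach_fix_type[of "norm b"]) auto
  then obtain x where "b + b * x = x" by blast
  then have "\<psi> x = \<psi> (b + b * x)" by simp
  then show False by (simp add: add mult b1)
qed

lemma character_in_dual: "\<psi> \<in> \<Delta> \<Longrightarrow> \<psi> \<in> dual"
proof -
  assume \<psi>: "\<psi> \<in> \<Delta>"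
  have "bounded_linear \<psi>"
  proof (rule bounded_linear_intro[where K = 1])
    fix r x
    show "\<psi> (r *\<^sub>R x) = r *\<^sub>R \<psi> x"
      using \<psi> by (simp add: characters_def scaleC_of_real[symmetric] scaleR_conv_of_real)
  qed (use \<psi> character_norm_le[OF \<psi>] in \<open>auto simp: characters_def\<close>)
  with \<psi> show "\<psi> \<in> dual" by (auto simp: characters_def dual_def)
qed

lemma dual_act_in_dual: "f \<in> dual \<Longrightarrow> dual_act f a \<in> dual"
  unfolding dual_def dual_act_def
  by (auto simp: mult_scaleC_right
      intro: bounded_linear_compose[OF _ bounded_linear_mult_right])


section \<open>Weak amenability and approximate identities\<close>

definition Delta_weak_amenable :: "('a::complex_banach_algebra \<Rightarrow> complex) \<Rightarrow> bool" where
  "Delta_weak_amenable \<phi> \<longleftrightarrow>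
     (\<exists>m\<in>bidual. m \<phi> = 0 \<and> (\<forall>a. \<phi> a = 0 \<longrightarrow> (\<forall>\<psi>\<in>\<Delta>. m (dual_act \<psi> a) = \<psi> a)))"

definition directed_set :: "'i set \<Rightarrow> ('i \<Rightarrow> 'i \<Rightarrow> bool) \<Rightarrow> bool" where
  "directed_set I le \<longleftrightarrow> I \<noteq> {} \<and> (\<forall>i\<in>I. le i i) \<and>
     (\<forall>i\<in>I. \<forall>j\<in>I. \<forall>k\<in>I. le i j \<longrightarrow> le j k \<longrightarrow> le i k) \<and>
     (\<forall>i\<in>I. \<forall>j\<in>I. \<exists>k\<in>I. le i k \<and> le j k)"

definition net_filter :: "'i set \<Rightarrow> ('i \<Rightarrow> 'i \<Rightarrow> bool) \<Rightarrow> 'i filter" where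
  "net_filter I le = (INF i\<in>I. principal {j\<in>I. le i j})"

lemma eventually_net_filter:
  assumes "directed_set I le"
  shows "eventually P (net_filter I le) \<longleftrightarrow> (\<exists>i\<in>I. \<forall>j\<in>I. le i j \<longrightarrow> P j)"
proof -
  have "eventually P (net_filter I le) \<longleftrightarrow>
      (\<exists>i\<in>I. eventually P (principal {j\<in>I. le i j}))"
    unfolding net_filter_def
  proof (rule eventually_INF_base)
    fix i j assume "i \<in> I" "j \<in> I"
    then obtain k where k: "k \<in> I" "le i k" "le j k"
      using assms unfolding directed_set_def by blast
    have "{l\<in>I. le k l} \<subseteq> {l\<in>I. le i l} \<inter> {l\<in>I. le j l}"
      using assms k \<open>i \<in> I\<close> \<open>j \<in> I\<close> unfolding directed_set_def by blast
    with k show "\<exists>x\<in>I. principal {l\<in>I. le x l} \<le>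
        inf (principal {l\<in>I. le i l}) (principal {l\<in>I. le j l})"
      by (intro bexI[of _ k]) auto
  qed (use assms in \<open>auto simp: directed_set_def\<close>)
  then show ?thesis by (auto simp: eventually_principal)
qed

definition bounded_Delta_weak_approx_id ::
    "'i set \<Rightarrow> ('i \<Rightarrow> 'i \<Rightarrow> bool) \<Rightarrow> ('i \<Rightarrow> 'a::complex_banach_algebra) \<Rightarrow> bool" where
  "bounded_Delta_weak_approx_id I le e \<longleftrightarrow>
     directed_set I le \<and> bounded (e ` I) \<and>
     (\<forall>a. \<forall>\<psi>\<in>\<Delta>. ((\<lambda>i. cmod (\<psi> (e i * a) - \<psi> a)) \<longlongrightarrow> 0) (net_filter I le))"

text \<open>
  Index types cannot be quantified over inside a formula, so existence has to be stated for a
  particular one.  Pairs of a point of the algebra and a subset of it suffice: such a net exists as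
  soon as there is one over any index type whatsoever.
\<close>

lemma bounded_Delta_weak_approx_id_canonical:
  fixes e :: "'i \<Rightarrow> 'a::complex_banach_algebra"
  assumes e: "bounded_Delta_weak_approx_id I le e"
  shows "\<exists>(J :: ('a \<times> 'a set) set) le' (e' :: 'a \<times> 'a set \<Rightarrow> 'a).
    bounded_Delta_weak_approx_id J le' e'"
proof -
  define T where "T i = e ` {j\<in>I. le i j}" for i
  define J where "J = {(x, S). \<exists>i\<in>I. S = T i \<and> x \<in> S}"
  define le' where "le' p q \<longleftrightarrow> snd q \<subseteq> snd p" for p q :: "'a \<times> 'a set"
  have dir: "directed_set I le" and bd: "bounded (e ` I)"
    using e by (auto simp: bounded_Delta_weak_approx_id_def)
  have refl: "le i i" if "i \<in> I" for i
    using dir that unfolding directed_set_def by blast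
  have inJ: "(e i, T i) \<in> J" if "i \<in> I" for i
    unfolding J_def T_def using refl[OF that] that by blast
  have mono: "T j \<subseteq> T i" if "i \<in> I" "j \<in> I" "le i j" for i j
    using dir that unfolding T_def directed_set_def by blast
  have dir': "directed_set J le'"
    unfolding directed_set_def
  proof (intro conjI ballI)
    have "I \<noteq> {}" using dir unfolding directed_set_def by blast
    then show "J \<noteq> {}" using inJ by blast
  next
    fix p q assume "p \<in> J" "q \<in> J"
    then obtain i j where ij: "i \<in> I" "j \<in> I" "snd p = T i" "snd q = T j"
      by (auto simp: J_def)
    then obtain k where "k \<in> I" "le i k" "le j k"
      using dir unfolding directed_set_def by blast
    with ij have "le' p (e k, T k) \<and> le' q (e k, T k)"
      by (simp add: le'_def mono)
    then show "\<exists>r\<in>J. le' p r \<and> le' q r"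
      using inJ[OF \<open>k \<in> I\<close>] by blast
  qed (auto simp: le'_def)
  have "fst ` J \<subseteq> e ` I" by (auto simp: J_def T_def)
  then have "bounded (fst ` J)" using bd bounded_subset by blast
  moreover have "((\<lambda>p. cmod (\<psi> (fst p * a) - \<psi> a)) \<longlongrightarrow> 0) (net_filter J le')"
    if "\<psi> \<in> \<Delta>" for a \<psi>
  proof (rule tendstoI)
    fix \<epsilon> :: real assume "\<epsilon> > 0"
    then have "eventually (\<lambda>i. dist (cmod (\<psi> (e i * a) - \<psi> a)) 0 < \<epsilon>) (net_filter I le)"
      using e that by (intro tendstoD) (auto simp: bounded_Delta_weak_approx_id_def)
    then obtain i where i: "i \<in> I"
        "\<And>j. j \<in> I \<Longrightarrow> le i j \<Longrightarrow> dist (cmod (\<psi> (e j * a) - \<psi> a)) 0 < \<epsilon>"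
      by (auto simp: eventually_net_filter[OF dir])
    then have "\<forall>q\<in>J. le' (e i, T i) q \<longrightarrow> dist (cmod (\<psi> (fst q * a) - \<psi> a)) 0 < \<epsilon>"
      by (auto simp: J_def le'_def T_def)
    then show "eventually (\<lambda>p. dist (cmod (\<psi> (fst p * a) - \<psi> a)) 0 < \<epsilon>) (net_filter J le')"
      unfolding eventually_net_filter[OF dir'] using inJ[OF i(1)] by blast
  qed
  ultimately show ?thesis
    using dir' unfolding bounded_Delta_weak_approx_id_def by blast
qed

end

theory Submission
  imports Defs
begin

text \<open>
  For characters \<open>\<psi>.a = \<psi>(a)\<psi>\<close>, so the functional \<open>m\<close> takes the value 1 at every character other
  than \<open>\<phi>\<close>.  By Helly's theorem, finitely many values of \<open>m\<close> are approximated by evaluation at points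
  \<open>x\<close> of a fixed ball.  To repair the value at \<open>\<phi>\<close>, pick \<open>u\<close> with \<open>\<phi>(u) = 1\<close> and replace \<open>x\<close> by
  \<open>x + u - xu\<close>, since \<open>1 - \<psi>(x + u - xu) = (1 - \<psi>(x))(1 - \<psi>(u))\<close>.
\<close>

section \<open>Linear combinations in the dual and their images under bidual elements\<close>

lemma dual_add:
  assumes "f \<in> dual" "g \<in> dual"
  shows "(\<lambda>x. f x + g x) \<in> dual"
  using assms by (auto simp: dual_def bounded_linear_add distrib_left)

lemma dual_cmult:
  assumes "f \<in> dual"
  shows "(\<lambda>x. c * f x) \<in> dual"
  using assms by (auto simp: dual_def intro: bounded_linear_compose[OF bounded_linear_mult_right])

lemma dual_zero: "(\<lambda>x. 0) \<in> dual"
  by (auto simp: dual_def)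

lemma dual_sum:
  assumes "\<And>f. f \<in> F \<Longrightarrow> h f \<in> dual"
  shows "(\<lambda>x. \<Sum>f\<in>F. h f x) \<in> dual"
  using assms
  by (induction F rule: infinite_finite_induct) (auto simp: dual_zero dual_add)

lemma bidual_add:
  "m \<in> bidual \<Longrightarrow> f \<in> dual \<Longrightarrow> g \<in> dual \<Longrightarrow> m (\<lambda>x. f x + g x) = m f + m g"
  by (simp add: bidual_def)

lemma bidual_cmult:
  "m \<in> bidual \<Longrightarrow> f \<in> dual \<Longrightarrow> m (\<lambda>x. c * f x) = c * m f"
  by (simp add: bidual_def)

lemma bidual_zero: "m \<in> bidual \<Longrightarrow> m (\<lambda>x. 0) = 0"
  using bidual_cmult[OF _ dual_zero, of m 0] by simp

lemma bidual_sum: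
  assumes "m \<in> bidual" "\<And>f. f \<in> F \<Longrightarrow> h f \<in> dual"
  shows "m (\<lambda>x. \<Sum>f\<in>F. h f x) = (\<Sum>f\<in>F. m (h f))"
  using assms(2)
proof (induction F rule: infinite_finite_induct)
  case (insert f F)
  then show ?case
    using bidual_add[OF assms(1), of "h f" "\<lambda>x. \<Sum>f\<in>F. h f x"] by (simp add: dual_sum)
qed (auto simp: bidual_zero[OF assms(1)])

section \<open>Approximating bidual elements by points of a ball\<close>

text \<open>The ball is invariant under complex phases: rotating \<open>x\<close> makes the value of
  \<open>g\<close> real and nonnegative, and scaling to norm \<open>M\<close> turns the bound on
  \<open>Re\<close> into a bound on \<open>cmod (g x)\<close>.\<close>

lemma onorm_le_if_Re_le:
  assumes g: "g \<in> dual" and "M > 0" and le: "\<And>y. norm y \<le> M \<Longrightarrow> Re (g y) \<le> s"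
  shows "M * onorm g \<le> s"
proof -
  interpret g: bounded_linear g using g by (simp add: dual_def)
  have "s \<ge> 0" using le[of 0] \<open>M > 0\<close> by (simp add: g.zero)
  have "cmod (g x) \<le> s / M * norm x" for x
  proof (cases "g x = 0")
    case False
    then have x: "norm x > 0" using g.zero by auto
    define c where "c = of_real (M / norm x) * (cnj (g x) / cmod (g x))"
    have "cmod c = M / norm x"
      using False x \<open>M > 0\<close> by (simp add: c_def norm_mult norm_divide)
    then have "norm (c *\<^sub>C x) \<le> M" using x by (simp add: norm_scaleC)
    then have "Re (g (c *\<^sub>C x)) \<le> s" by (rule le)
    also have "g (c *\<^sub>C x) = c * g x" using g by (simp add: dual_def)
    also have "c * g x = of_real (M / norm x) * ((g x * cnj (g x)) / cmod (g x))"
      by (simp add: c_def)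
    also have "\<dots> = of_real (M / norm x * cmod (g x))"
      using False
      by (simp add: complex_norm_square[symmetric] power2_eq_square)
    finally show ?thesis using x \<open>M > 0\<close> by (simp add: field_simps)
  qed (use \<open>s \<ge> 0\<close> \<open>M > 0\<close> in simp)
  then have "onorm g \<le> s / M"
    using \<open>s \<ge> 0\<close> \<open>M > 0\<close> by (intro onorm_bound) auto
  then show ?thesis using \<open>M > 0\<close> by (simp add: field_simps)
qed

lemma cmod_diff_scaleR_power2:
  "(cmod (a - t *\<^sub>R b))\<^sup>2 = (cmod a)\<^sup>2 - 2 * t * Re (cnj a * b) + t\<^sup>2 * (cmod b)\<^sup>2"
  unfolding cmod_power2 by (simp add: power2_eq_square algebra_simps)

text \<open>
  Helly's theorem without Hahn--Banach: take a near-minimiser \<open>x\<close> of \<open>\<Sum>f\<in>F. \<bar>m f - f x\<bar>\<^sup>2\<close> on the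
  ball and test the bound on \<open>m\<close> against the functional \<open>g = \<Sum>f\<in>F. cnj (m f - f x) f\<close>.
  Near-minimality makes \<open>Re (g x)\<close> almost equal to the supremum of \<open>Re g\<close> on the ball,
  while \<open>m g - g x\<close> is the minimised sum.
\<close>

lemma bidual_approx:
  fixes m :: "('a::complex_banach_algebra \<Rightarrow> complex) \<Rightarrow> complex"
  assumes m: "m \<in> bidual"
  obtains M where "\<And>F \<epsilon>. finite F \<Longrightarrow> F \<subseteq> dual \<Longrightarrow> \<epsilon> > 0 \<Longrightarrow>
    \<exists>x. norm x \<le> M \<and> (\<forall>f\<in>F. cmod (m f - f x) < \<epsilon>)"
proof -
  obtain K where K: "\<And>f. f \<in> dual \<Longrightarrow> cmod (m f) \<le> K * onorm f"
    using m unfolding bidual_def by blast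
  \<comment> \<open>\<open>K\<close> may be nonpositive, while the ball needs a positive
    radius.\<close>
  define M where "M = max K 1"
  have "M > 0" by (simp add: M_def)
  have M: "cmod (m f) \<le> M * onorm f" if "f \<in> dual" for f
  proof -
    have "0 \<le> onorm f" using that by (simp add: dual_def onorm_pos_le)
    then have "K * onorm f \<le> M * onorm f" by (intro mult_right_mono) (auto simp: M_def)
    with K[OF that] show ?thesis by simp
  qed
  have "\<exists>x. norm x \<le> M \<and> (\<forall>f\<in>F. cmod (m f - f x) < \<epsilon>)"
    if "finite F" and F: "F \<subseteq> dual" and "\<epsilon> > 0" for F \<epsilon>
  proof -
    have bl: "bounded_linear f" if "f \<in> F" for f using F that by (auto simp: dual_def)
    define Q where "Q x = (\<Sum>f\<in>F. (cmod (m f - f x))\<^sup>2)" for x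
    define d where "d = Inf (Q ` cball 0 M)"
    have bdd: "bdd_below (Q ` cball 0 M)"
      by (intro bdd_belowI[of _ 0]) (auto simp: Q_def sum_nonneg)
    \<comment> \<open>\<open>B\<close> bounds the second-order coefficient of \<open>Q\<close> along
      segments in the ball, whose points are at most \<open>2 * M\<close> apart. The number
      \<open>t\<close> serves as step length and, squared, as slack in near-minimality, so that
      division by \<open>t\<close> leaves an error of order \<open>t * (1 + B)\<close>.\<close>
    define B where "B = (\<Sum>f\<in>F. (onorm f * (2 * M))\<^sup>2)"
    have "B \<ge> 0" by (simp add: B_def sum_nonneg)
    define t where "t = min 1 (\<epsilon>\<^sup>2 / (1 + B))"
    have t: "0 < t" "t \<le> 1" using \<open>\<epsilon> > 0\<close> \<open>B \<ge> 0\<close> by (auto simp: t_def)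
    have tB: "t * (1 + B) \<le> \<epsilon>\<^sup>2"
      using \<open>B \<ge> 0\<close> by (simp add: t_def flip: pos_le_divide_eq)
    have "Q ` cball 0 M \<noteq> {}" using \<open>M > 0\<close> by auto
    moreover have "d < d + t\<^sup>2" using t by simp
    ultimately have "\<exists>q\<in>Q ` cball 0 M. q < d + t\<^sup>2"
      using cInf_lessD[of "Q ` cball 0 M" "d + t\<^sup>2"] by (simp add: d_def)
    then obtain x where x: "norm x \<le> M" "Q x < d + t\<^sup>2"
      by auto
    define g where "g y = (\<Sum>f\<in>F. cnj (m f - f x) * f y)" for y
    have g: "g \<in> dual"
      unfolding g_def[abs_def] using F by (intro dual_sum dual_cmult) auto
    have mg: "m g = (\<Sum>f\<in>F. cnj (m f - f x) * m f)"
    proof -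
      have "m g = (\<Sum>f\<in>F. m (\<lambda>y. cnj (m f - f x) * f y))"
        unfolding g_def[abs_def] using F by (intro bidual_sum[OF m] dual_cmult) auto
      also have "\<dots> = (\<Sum>f\<in>F. cnj (m f - f x) * m f)"
        using F by (intro sum.cong refl bidual_cmult[OF m]) auto
      finally show ?thesis .
    qed
    have Re_g: "Re (g y) \<le> Re (g x) + t * (1 + B) / 2" if y: "norm y \<le> M" for y
    proof -
      \<comment> \<open>First-order optimality: a step of length \<open>t\<close> towards
        \<open>y\<close> stays in the ball by convexity and changes \<open>Q\<close> by
        \<open>- 2 * t * (Re (g y) - Re (g x))\<close> plus at most \<open>t\<^sup>2 * B\<close>. It
        cannot lower \<open>Q\<close> by more than \<open>t\<^sup>2\<close>, so dividing by
        \<open>2 * t\<close> gives the claim.\<close>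
      define z where "z = x + t *\<^sub>R (y - x)"
      have "z = (1 - t) *\<^sub>R x + t *\<^sub>R y" by (simp add: z_def algebra_simps)
      also have "\<dots> \<in> cball 0 M"
        using x y t by (intro convexD[OF convex_cball]) auto
      finally have "d \<le> Q z" unfolding d_def using bdd by (intro cInf_lower) auto
      have fz: "(cmod (m f - f z))\<^sup>2 = (cmod (m f - f x))\<^sup>2
          - 2 * t * (Re (cnj (m f - f x) * f y) - Re (cnj (m f - f x) * f x))
          + t\<^sup>2 * (cmod (f (y - x)))\<^sup>2" if "f \<in> F" for f
      proof -
        interpret f: bounded_linear f by (rule bl[OF that])
        have eq: "m f - f z = (m f - f x) - t *\<^sub>R f (y - x)"
          by (simp add: z_def f.add f.scaleR)
        show ?thesis
          unfolding eq cmod_diff_scaleR_power2 by (simp add: f.diff right_diff_distrib)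
      qed
      have "Q z = (\<Sum>f\<in>F. (cmod (m f - f x))\<^sup>2
          - 2 * t * (Re (cnj (m f - f x) * f y) - Re (cnj (m f - f x) * f x))
          + t\<^sup>2 * (cmod (f (y - x)))\<^sup>2)"
        unfolding Q_def by (intro sum.cong refl fz)
      also have "\<dots> = Q x - 2 * t * (Re (g y) - Re (g x)) + t\<^sup>2 * (\<Sum>f\<in>F. (cmod (f (y - x)))\<^sup>2)"
        unfolding Q_def g_def Re_sum
        by (simp only: sum.distrib sum_subtractf sum_distrib_left[symmetric])
      also have "(\<Sum>f\<in>F. (cmod (f (y - x)))\<^sup>2) \<le> B"
        unfolding B_def
      proof (intro sum_mono power_mono)
        fix f assume "f \<in> F"
        have "norm (y - x) \<le> 2 * M" using norm_triangle_ineq4[of y x] x y by simp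
        then have "onorm f * norm (y - x) \<le> onorm f * (2 * M)"
          by (intro mult_left_mono onorm_pos_le bl[OF \<open>f \<in> F\<close>])
        then show "cmod (f (y - x)) \<le> onorm f * (2 * M)"
          using onorm[OF bl[OF \<open>f \<in> F\<close>], of "y - x"] by simp
      qed simp
      finally have "Q z \<le> Q x - 2 * t * (Re (g y) - Re (g x)) + t\<^sup>2 * B"
        by (simp add: mult_left_mono)
      with \<open>d \<le> Q z\<close> x(2) have "t * (2 * (Re (g y) - Re (g x))) \<le> t * (t * (1 + B))"
        by (simp add: algebra_simps power2_eq_square)
      then show ?thesis using t by simp
    qed
    have "m g - g x = (\<Sum>f\<in>F. (m f - f x) * cnj (m f - f x))"
      unfolding mg g_def by (simp add: sum_subtractf sum.distrib algebra_simps)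
    also have "\<dots> = of_real (Q x)"
      unfolding Q_def by (simp only: complex_norm_square of_real_sum)
    finally have "Q x = Re (m g - g x)" by simp
    \<comment> \<open>The bound on \<open>m\<close> meets the bound on \<open>g\<close> over the
      ball: \<open>Re (m g)\<close> is at most \<open>M * onorm g\<close>, which exceeds
      \<open>Re (g x)\<close> by at most \<open>t * (1 + B) / 2\<close>.\<close>
    also have "\<dots> \<le> M * onorm g - Re (g x)"
      using complex_Re_le_cmod[of "m g"] M[OF g] by simp
    also have "\<dots> \<le> t * (1 + B) / 2"
      using onorm_le_if_Re_le[OF g \<open>M > 0\<close> Re_g] by simp
    also have "\<dots> < \<epsilon>\<^sup>2" 
    proof -
      have "\<epsilon>\<^sup>2 > 0" using \<open>\<epsilon> > 0\<close> by simp
      with tB show ?thesis by linarith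
    qed
    finally have "Q x < \<epsilon>\<^sup>2" .
    have "cmod (m f - f x) < \<epsilon>" if "f \<in> F" for f
    proof -
      have "(cmod (m f - f x))\<^sup>2 \<le> Q x"
        unfolding Q_def using that \<open>finite F\<close> by (intro member_le_sum) auto
      then have "(cmod (m f - f x))\<^sup>2 < \<epsilon>\<^sup>2" using \<open>Q x < \<epsilon>\<^sup>2\<close> by simp
      then show ?thesis using \<open>\<epsilon> > 0\<close> by (simp add: power2_less_imp_less)
    qed
    with x show ?thesis by blast
  qed
  then show ?thesis by (rule that)
qed

section \<open>The values of \<open>m\<close> at characters\<close>

text \<open>For nonzero \<open>\<phi>\<close>, an inclusion of kernels would make
  \<open>\<psi>\<close> a multiple of \<open>\<phi>\<close>; multiplicativity makes the factor
  idempotent, hence 1 because \<open>\<psi>\<close> is nonzero.\<close>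

lemma character_separates:
  assumes \<psi>: "\<psi> \<in> \<Delta>" and \<phi>: "\<phi> \<in> \<Delta> \<union> {\<lambda>_. 0}" and "\<psi> \<noteq> \<phi>"
  obtains a where "\<phi> a = 0" "\<psi> a \<noteq> 0"
proof (cases "\<phi> \<in> \<Delta>")
  case False
  then have "\<phi> = (\<lambda>_. 0)" using \<phi> by simp
  with \<psi> that show ?thesis by (auto simp: characters_def)
next
  case True
  have add: "\<And>x y. \<psi> (x + y) = \<psi> x + \<psi> y" "\<And>x y. \<phi> (x + y) = \<phi> x + \<phi> y"
    and sc: "\<And>c x. \<psi> (c *\<^sub>C x) = c * \<psi> x" "\<And>c x. \<phi> (c *\<^sub>C x) = c * \<phi> x"
    and mult: "\<And>x y. \<psi> (x * y) = \<psi> x * \<psi> y" "\<And>x y. \<phi> (x * y) = \<phi> x * \<phi> y"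
    using \<psi> True by (auto simp: characters_def)
  obtain v where "\<phi> v \<noteq> 0" using True by (auto simp: characters_def)
  define u where "u = inverse (\<phi> v) *\<^sub>C v"
  have u: "\<phi> u = 1" using \<open>\<phi> v \<noteq> 0\<close> by (simp add: u_def sc)
  show ?thesis
  proof (rule ccontr)
    assume "\<not> ?thesis"
    with that have ker: "\<psi> a = 0" if "\<phi> a = 0" for a using that by blast
    \<comment> \<open>Since \<open>\<phi> u = 1\<close>, subtracting the multiple
      \<open>\<phi> x\<close> of \<open>u\<close> from \<open>x\<close> lands in the kernel of
      \<open>\<phi>\<close>.\<close>
    have eq: "\<psi> x = \<phi> x * \<psi> u" for x
      using ker[of "x + (- \<phi> x) *\<^sub>C u"] by (simp add: add sc u)
    have "\<psi> u * \<psi> u = \<psi> u" using mult[of u u] eq[of "u * u"] u by simp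
    moreover have "\<psi> u \<noteq> 0" 
    proof
      assume "\<psi> u = 0"
      then have "\<psi> x = 0" for x using eq[of x] by simp
      with \<psi> show False by (simp add: characters_def)
    qed
    ultimately have "\<psi> u = 1" by simp
    then have "\<psi> x = \<phi> x" for x using eq[of x] by simp
    then have "\<psi> = \<phi>" ..
    with \<open>\<psi> \<noteq> \<phi>\<close> show False ..
  qed
qed

text \<open>At a point \<open>a\<close> of the kernel of \<open>\<phi>\<close> with
  \<open>\<psi> a \<noteq> 0\<close>, the hypothesis reads
  \<open>\<psi> a * m \<psi> = \<psi> a\<close>, and \<open>\<psi> a\<close> cancels.\<close>

lemma bidual_character_eq_1:
  assumes m: "m \<in> bidual" "\<forall>a. \<phi> a = 0 \<longrightarrow> (\<forall>\<psi>\<in>\<Delta>. m (dual_act \<psi> a) = \<psi> a)"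
    and \<psi>: "\<psi> \<in> \<Delta>" and \<phi>: "\<phi> \<in> \<Delta> \<union> {\<lambda>_. 0}" and "\<psi> \<noteq> \<phi>"
  shows "m \<psi> = 1"
proof -
  obtain a where a: "\<phi> a = 0" "\<psi> a \<noteq> 0" using character_separates[OF \<psi> \<phi> \<open>\<psi> \<noteq> \<phi>\<close>] .
  have "dual_act \<psi> a = (\<lambda>b. \<psi> a * \<psi> b)"
    using \<psi> by (auto simp: dual_act_def characters_def)
  then have "m (dual_act \<psi> a) = \<psi> a * m \<psi>"
    using bidual_cmult[OF m(1) character_in_dual[OF \<psi>], of "\<psi> a"] by simp
  with m(2) a \<psi> show ?thesis by simp
qed

section \<open>From finite approximation to a net\<close>

text \<open>Because \<open>\<psi> (x * a) - \<psi> a = (\<psi> x - 1) * \<psi> a\<close>, it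
  suffices that characters tend to 1 along the net. The indices are finite sets of characters paired
  with a natural number \<open>n\<close> encoding the tolerance \<open>1 / (n + 1)\<close>.\<close>

lemma bounded_Delta_weak_approx_id_if_finite_approx:
  fixes C :: real
  assumes approx: "\<And>F \<epsilon>. finite F \<Longrightarrow> F \<subseteq> (\<Delta> :: ('a::complex_banach_algebra \<Rightarrow> complex) set) \<Longrightarrow>
    \<epsilon> > 0 \<Longrightarrow> \<exists>x. norm x \<le> C \<and> (\<forall>\<psi>\<in>F. cmod (\<psi> x - 1) < \<epsilon>)"
  shows "\<exists>(I :: ('a \<times> 'a set) set) le (e :: 'a \<times> 'a set \<Rightarrow> 'a).
    bounded_Delta_weak_approx_id I le e"
proof -
  define I :: "(('a \<Rightarrow> complex) set \<times> nat) set"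
    where "I = {F. finite F \<and> F \<subseteq> \<Delta>} \<times> UNIV"
  define le :: "('a \<Rightarrow> complex) set \<times> nat \<Rightarrow> ('a \<Rightarrow> complex) set \<times> nat \<Rightarrow> bool"
    where "le p q \<longleftrightarrow> fst p \<subseteq> fst q \<and> snd p \<le> snd q" for p q
  have "\<forall>p\<in>I. \<exists>x. norm x \<le> C \<and> (\<forall>\<psi>\<in>fst p. cmod (\<psi> x - 1) < inverse (real (Suc (snd p))))"
    by (intro ballI approx) (auto simp: I_def)
  then obtain e where
    e: "\<And>p. p \<in> I \<Longrightarrow> norm (e p) \<le> C"
      "\<And>p \<psi>. p \<in> I \<Longrightarrow> \<psi> \<in> fst p \<Longrightarrow> cmod (\<psi> (e p) - 1) < inverse (real (Suc (snd p)))"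
    by metis
  have dir: "directed_set I le"
    unfolding directed_set_def
  proof (intro conjI ballI)
    show "I \<noteq> {}" by (auto simp: I_def)
  next
    fix p q assume "p \<in> I" "q \<in> I"
    then show "\<exists>r\<in>I. le p r \<and> le q r"
      by (intro bexI[of _ "(fst p \<union> fst q, max (snd p) (snd q))"]) (auto simp: I_def le_def)
  qed (auto simp: le_def)
  have "bounded (e ` I)" using e(1) unfolding bounded_iff by blast
  moreover have "((\<lambda>i. cmod (\<psi> (e i * a) - \<psi> a)) \<longlongrightarrow> 0) (net_filter I le)"
    if "\<psi> \<in> \<Delta>" for a \<psi>
  proof (rule tendstoI)
    fix \<epsilon> :: real assume "\<epsilon> > 0"
    \<comment> \<open>Adding 1 keeps the denominator positive when
      \<open>\<psi> a = 0\<close>.\<close>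
    then have "\<epsilon> / (cmod (\<psi> a) + 1) > 0" by (simp add: add_nonneg_pos)
    then obtain n where n: "inverse (real (Suc n)) < \<epsilon> / (cmod (\<psi> a) + 1)"
      using reals_Archimedean by blast
    have "dist (cmod (\<psi> (e q * a) - \<psi> a)) 0 < \<epsilon>" if q: "q \<in> I" "le ({\<psi>}, n) q" for q
    proof -
      have "cmod (\<psi> (e q) - 1) < inverse (real (Suc (snd q)))"
        using q by (intro e(2)) (auto simp: le_def)
      also have "\<dots> \<le> inverse (real (Suc n))"
        using q by (intro le_imp_inverse_le) (auto simp: le_def)
      finally have small: "cmod (\<psi> (e q) - 1) < \<epsilon> / (cmod (\<psi> a) + 1)" using n by simp
      have "\<psi> (e q * a) - \<psi> a = (\<psi> (e q) - 1) * \<psi> a"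
        using \<open>\<psi> \<in> \<Delta>\<close> by (simp add: characters_def algebra_simps)
      then have "cmod (\<psi> (e q * a) - \<psi> a) \<le> cmod (\<psi> (e q) - 1) * (cmod (\<psi> a) + 1)"
        by (simp add: norm_mult mult_left_mono)
      also have "\<dots> < \<epsilon>" using small by (simp add: pos_less_divide_eq add_nonneg_pos)
      finally show ?thesis by simp
    qed
    moreover have "({\<psi>}, n) \<in> I" using that by (simp add: I_def)
    ultimately show "eventually (\<lambda>i. dist (cmod (\<psi> (e i * a) - \<psi> a)) 0 < \<epsilon>) (net_filter I le)"
      unfolding eventually_net_filter[OF dir] by blast
  qed
  ultimately have "bounded_Delta_weak_approx_id I le e"
    using dir by (simp add: bounded_Delta_weak_approx_id_def)
  then show ?thesis by (rule bounded_Delta_weak_approx_id_canonical)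
qed

section \<open>Correcting the value at \<open>\<phi>\<close>\<close>

theorem corollary2p8:
  fixes \<phi> :: "'a::complex_banach_algebra \<Rightarrow> complex"
  assumes "(\<Delta> :: ('a \<Rightarrow> complex) set) \<noteq> {}"
    and "\<phi> \<in> \<Delta> \<union> {\<lambda>_. 0}"
    and "Delta_weak_amenable \<phi>"
  shows "\<exists>(I :: ('a \<times> 'a set) set) le (e :: 'a \<times> 'a set \<Rightarrow> 'a).
    bounded_Delta_weak_approx_id I le e"
proof -
  obtain m where m: "m \<in> bidual" "\<forall>a. \<phi> a = 0 \<longrightarrow> (\<forall>\<psi>\<in>\<Delta>. m (dual_act \<psi> a) = \<psi> a)"
    using assms(3) by (auto simp: Delta_weak_amenable_def)
  obtain M where M: "\<And>F \<epsilon>. finite F \<Longrightarrow> F \<subseteq> dual \<Longrightarrow> \<epsilon> > 0 \<Longrightarrow>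
      \<exists>x. norm x \<le> M \<and> (\<forall>f\<in>F. cmod (m f - f x) < \<epsilon>)"
    using bidual_approx[OF m(1)] by blast
  \<comment> \<open>If \<open>\<phi>\<close> is zero, \<open>u\<close> is arbitrary: no character in
    \<open>F\<close> then equals \<open>\<phi>\<close>. As \<open>u\<close> is fixed before
    \<open>F\<close> and \<open>\<epsilon>\<close>, the final norm bound is uniform.\<close>
  obtain u where u: "\<phi> \<in> \<Delta> \<Longrightarrow> \<phi> u = 1"
  proof (cases "\<phi> \<in> \<Delta>")
    case True
    then obtain v where "\<phi> v \<noteq> 0" by (auto simp: characters_def)
    then have "\<phi> (inverse (\<phi> v) *\<^sub>C v) = 1" using True by (simp add: characters_def)
    then show ?thesis using that by blast
  qed (use that in blast)
  show ?thesis
  proof (rule bounded_Delta_weak_approx_id_if_finite_approx)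
    fix F :: "('a \<Rightarrow> complex) set" and \<epsilon> :: real
    assume F: "finite F" "F \<subseteq> \<Delta>" and "\<epsilon> > 0"
    \<comment> \<open>Characters are contractive, so the second factor \<open>\<psi> u - 1\<close>
      has modulus at most \<open>1 + norm u\<close>; the 2 makes the final inequality
      strict.\<close>
    define \<delta> where "\<delta> = \<epsilon> / (2 + norm u)"
    have "2 + norm u > 0" by (simp add: add_pos_nonneg)
    with \<open>\<epsilon> > 0\<close> have "\<delta> > 0" by (simp add: \<delta>_def)
    then obtain x where x: "norm x \<le> M" "\<And>f. f \<in> F \<Longrightarrow> cmod (m f - f x) < \<delta>"
      using M[of F \<delta>] F character_in_dual by blast
    \<comment> \<open>This is \<open>x + u - x * u\<close>, written with sums and complex multiples
      so that the defining equations of a character evaluate it directly.\<close>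
    define e where "e = x + (1 *\<^sub>C u + (- 1) *\<^sub>C (x * u))"
    have "norm e \<le> norm x + (norm u + norm x * norm u)"
      unfolding e_def
      by (intro order_trans[OF norm_triangle_ineq] add_mono order_refl)
         (auto simp: norm_scaleC norm_mult_ineq)
    also have "\<dots> \<le> M + (norm u + M * norm u)"
      using x(1) by (intro add_mono mult_right_mono) auto
    finally have "norm e \<le> M + (norm u + M * norm u)" .
    moreover have "cmod (\<psi> e - 1) < \<epsilon>" if "\<psi> \<in> F" for \<psi>
    proof -
      have \<psi>: "\<psi> \<in> \<Delta>" using that F by blast
      have "\<psi> e - 1 = (1 - \<psi> x) * (\<psi> u - 1)"
        using \<psi> unfolding e_def characters_def
        by (simp only: mem_Collect_eq) (simp add: algebra_simps)
      then have eq: "cmod (\<psi> e - 1) = cmod (1 - \<psi> x) * cmod (\<psi> u - 1)" by (simp add: norm_mult)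
      show ?thesis
      proof (cases "\<psi> = \<phi>")
        case True
        \<comment> \<open>The factor \<open>\<psi> u - 1\<close> vanishes here, whatever the value
          at \<open>x\<close>.\<close>
        then show ?thesis using u \<psi> eq \<open>\<epsilon> > 0\<close> by simp
      next
        case False
        have "m \<psi> = 1" using bidual_character_eq_1[OF m \<psi> assms(2) False] .
        then have "cmod (1 - \<psi> x) < \<delta>" using x(2)[OF that] by simp
        moreover have "cmod (\<psi> u - 1) \<le> 1 + norm u"
          using norm_triangle_ineq4[of "\<psi> u" 1] character_norm_le[OF \<psi>, of u] by simp
        ultimately have "cmod (\<psi> e - 1) \<le> \<delta> * (1 + norm u)"
          unfolding eq using \<open>\<delta> > 0\<close> by (intro mult_mono) auto
        also have "\<dots> < \<delta> * (2 + norm u)" using \<open>\<delta> > 0\<close> by simp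
        also have "\<dots> = \<epsilon>" using \<open>2 + norm u > 0\<close> by (simp add: \<delta>_def)
        finally show ?thesis .
      qed
    qed
    ultimately show "\<exists>x. norm x \<le> M + (norm u + M * norm u) \<and> (\<forall>\<psi>\<in>F. cmod (\<psi> x - 1) < \<epsilon>)"
      by blast
  qed
qed

end
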